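(* Let $F$ be an absolutely continuous probability distribution function on $\mathbb{R}$ with density $f$, let $\overline{F}:=1-F$, let $q\in\mathbb{R}$, and suppose that $f$ is continuous at $1-q$ and that $p:=\overline{F}(1-q)$ satisfies $0<p<1$. Let $(\varepsilon_n)_{n\ge 1}$ be a sequence of positive real numbers such that $n^2\varepsilon_n\to 0$ as $n\to\infty$. For each $n$ let $B_n:=Y(1)+\dots+Y(n)$, where $Y(1),\dots,Y(n)$ is the $\{0,1\}$-valued process with parameters $(F,q,\varepsilon_n)$ defined in the context, and let $p_n(k)=\binom{n}{k}p^k(1-p)^{n-k}$, $k=0,1,\dots,n$, be the probability function of the $\mathrm{Binomial}(n,p)$ distribution. Then $$\lim_{n\to\infty}\frac{\mathbb{P}[B_n=k]}{p_n(k)}=1\qquad\text{for all } k\in\{0,1,\dots,n\},$$ that is, for every sequence of integers $(k_n)_{n\ge1}$ with $k_n\in\{0,1,\dots,n\}$ one has $\lim_{n\to\infty}\mathbb{P}[B_n=k_n]/p_n(k_n)=1$.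
   Context: A student attends a course of $n$ sessions; $Y(j)=1$ if session $j$ is understood and $Y(j)=0$ otherwise, so $B_n$ is the number of understood sessions. Here $q$ is the quality parameter and $\varepsilon>0$ the dependence parameter, which is fixed within one course but depends on the number $n$ of sessions. The process with parameters $(F,q,\varepsilon)$ is defined by $\mathbb{P}[Y(1)=1]=\overline{F}(1-q)$ and, for all $1\le j\le n-1$ and all $(x_1,\dots,x_j)\in\{0,1\}^j$ with $\mathbb{P}[Y(1)=x_1,\dots,Y(j)=x_j]>0$, $$\mathbb{P}\left[Y(j+1)=1\mid Y(1)=x_1,\dots,Y(j)=x_j\right]=\overline{F}\left(1-q+(j-2s)\varepsilon\right),\qquad s:=x_1+\dots+x_j.$$ (Each understood session decreases the argument of $\overline{F}$ by $\varepsilon$; each session not understood increases it by $\varepsilon$.) *)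

theory Defs
  imports "HOL-Probability.Probability"
begin

definition tail_fun :: "(real \<Rightarrow> real) \<Rightarrow> real \<Rightarrow> real" where
  "tail_fun F t = 1 - F t"

text \<open>
  \<^term>\<open>is_density_of f F\<close>: the distribution function \<open>F\<close> is absolutely continuous with
  density \<open>f\<close>. The \<^const>\<open>prob_space\<close> conjunct says that \<open>f\<close> has total integral 1.
\<close>
definition is_density_of :: "(real \<Rightarrow> real) \<Rightarrow> (real \<Rightarrow> real) \<Rightarrow> bool" where
  "is_density_of f F \<longleftrightarrow>
     f \<in> borel_measurable borel \<and> (\<forall>t. 0 \<le> f t) \<and>
     prob_space (density lborel f) \<and> F = cdf (density lborel f)"

text \<open>
  The variables are indexed from 1, so only \<open>Y 1, \<dots>, Y n\<close> are constrained. Measurability into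
  \<open>count_space {0, 1}\<close> includes that \<open>Y j\<close> takes only the values 0 and 1.
\<close>
definition course_process ::
  "'a measure \<Rightarrow> (real \<Rightarrow> real) \<Rightarrow> real \<Rightarrow> real \<Rightarrow> nat \<Rightarrow> (nat \<Rightarrow> 'a \<Rightarrow> nat) \<Rightarrow> bool" where
  "course_process M F q \<epsilon> n Y \<longleftrightarrow>
     prob_space M \<and>
     (\<forall>j\<in>{1..n}. Y j \<in> measurable M (count_space {0, 1})) \<and>
     \<P>(\<omega> in M. Y 1 \<omega> = 1) = tail_fun F (1 - q) \<and>
     (\<forall>j\<in>{1..<n}. \<forall>x \<in> {1..j} \<rightarrow> {0, 1}.
        \<P>(\<omega> in M. \<forall>i\<in>{1..j}. Y i \<omega> = x i) > 0 \<longrightarrow>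
        \<P>(\<omega> in M. Y (j + 1) \<omega> = 1 \<bar> \<forall>i\<in>{1..j}. Y i \<omega> = x i) =
          tail_fun F (1 - q + (real j - 2 * real (\<Sum>i=1..j. x i)) * \<epsilon>))"

end

theory Submission
  imports Defs
begin

text \<open>
  Fix an outcome \<open>x\<close> of all \<open>n\<close> sessions, with \<open>k\<close> sessions understood. Its probability is a product
  of \<open>n\<close> conditional probabilities, in each of which the argument of the tail function differs from
  \<open>1 - q\<close> by at most \<open>n * \<epsilon>\<close>. Since the density is continuous at \<open>1 - q\<close>, hence bounded nearby, the tail
  function is Lipschitz at that point (\<open>tail_fun_lipschitz_at\<close>), so each factor agrees with the factor
  \<open>p\<close> or \<open>1 - p\<close> of independent sessions up to a relative error \<open>r = O(n * \<epsilon>)\<close>. Multiplying, the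
  probability of \<open>x\<close> lies between \<open>(1 - r)^n\<close> and \<open>(1 + r)^n\<close> times \<open>p^k * (1 - p)^(n - k)\<close>
  (\<open>path_prob_bounds\<close>).

  These bounds do not depend on \<open>x\<close>, so they survive summation over the \<open>n choose k\<close> outcomes with
  \<open>k\<close> sessions understood (\<open>count_prob_bounds\<close>): the ratio to the binomial probability is between
  \<open>(1 - r)^n\<close> and \<open>(1 + r)^n\<close>, whatever \<open>k\<close> is. Both tend to 1 because
  \<open>n * r = O(n\<^sup>2 * \<epsilon>)\<close> tends to 0; in particular the arguments are eventually in the range of
  the Lipschitz bound and \<open>r < 1\<close>.
\<close>

section \<open>Local Lipschitz bound for the tail function\<close>

text \<open>
  Near a continuity point the density is at most \<open>K = f c + 1\<close>, so an interval of length \<open>\<bar>h\<bar>\<close> with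
  endpoint \<open>c\<close> has mass at most \<open>K * \<bar>h\<bar>\<close>.
\<close>
lemma tail_fun_lipschitz_at:
  assumes dens: "is_density_of f F" and cont: "isCont f c"
  obtains K \<delta> where "K > 0" "\<delta> > 0"
    "\<And>h. \<bar>h\<bar> \<le> \<delta> \<Longrightarrow> \<bar>tail_fun F (c + h) - tail_fun F c\<bar> \<le> K * \<bar>h\<bar>"
proof -
  let ?D = "density lborel f"
  from dens have f_meas: "f \<in> borel_measurable borel" and f_nonneg: "\<And>t. 0 \<le> f t"
    and prob: "prob_space ?D" and F: "F = cdf ?D"
    unfolding is_density_of_def by auto
  interpret prob_space ?D by (rule prob)
  interpret finite_borel_measure ?D
    by unfold_locales simp
  define K where "K = f c + 1"
  have K: "K > 0" using f_nonneg[of c] by (simp add: K_def)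
  from cont have "\<exists>d>0. \<forall>x. dist x c < d \<longrightarrow> dist (f x) (f c) < 1"
    unfolding continuous_at_eps_delta by (auto simp: dist_real_def)
  then obtain d where d: "d > 0" and near: "\<And>x. dist x c < d \<Longrightarrow> dist (f x) (f c) < 1"
    by blast
  have f_le: "f x \<le> K" if "\<bar>x - c\<bar> < d" for x
    using near[of x] that by (simp add: dist_real_def K_def)
  have incr: "F b - F a \<le> K * (b - a)"
    if "a < b" and sub: "\<And>x. x \<in> {a<..b} \<Longrightarrow> \<bar>x - c\<bar> < d" for a b
  proof -
    have "emeasure ?D {a<..b} = (\<integral>\<^sup>+x. ennreal (f x) * indicator {a<..b} x \<partial>lborel)"
      using f_meas by (simp add: emeasure_density)
    also have "\<dots> \<le> (\<integral>\<^sup>+x. ennreal K * indicator {a<..b} x \<partial>lborel)"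
      by (intro nn_integral_mono)
        (auto simp: indicator_def intro!: ennreal_leI f_le sub)
    also have "\<dots> = ennreal (K * (b - a))"
      using that(1) K by (simp add: nn_integral_cmult_indicator ennreal_mult)
    finally have "measure ?D {a<..b} \<le> K * (b - a)"
      using that(1) K by (simp add: emeasure_eq_measure)
    then show ?thesis using cdf_diff_eq[OF that(1)] by (simp add: F)
  qed
  have mono: "F a \<le> F b" if "a \<le> b" for a b
    using cdf_nondecreasing[OF that] by (simp add: F)
  have "\<bar>tail_fun F (c + h) - tail_fun F c\<bar> \<le> K * \<bar>h\<bar>" if "\<bar>h\<bar> \<le> d / 2" for h
  proof -
    consider "h = 0" | "h > 0" | "h < 0" by linarith
    then show ?thesis
    proof cases
      case 1 then show ?thesis by simp
    next
      case 2
      then show ?thesis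
        using incr[of c "c + h"] mono[of c "c + h"] that d by (simp add: tail_fun_def)
    next
      case 3
      then show ?thesis
        using incr[of "c + h" c] mono[of "c + h" c] that d by (simp add: tail_fun_def)
    qed
  qed
  with K d show ?thesis using that[of K "d / 2"] by simp
qed

section \<open>Probability of a single outcome\<close>

text \<open>
  An outcome of the first \<open>j\<close> sessions is encoded by the set \<open>S\<close> of understood sessions, so that the
  outcomes with a given number of understood sessions are counted by \<open>n_subsets\<close>.
\<close>
definition path_event :: "'a measure \<Rightarrow> (nat \<Rightarrow> 'a \<Rightarrow> nat) \<Rightarrow> nat set \<Rightarrow> nat \<Rightarrow> 'a set" where
  "path_event M Y S j = {\<omega> \<in> space M. \<forall>i\<in>{1..j}. Y i \<omega> = of_bool (i \<in> S)}"

lemma course_process_value: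
  assumes "course_process M F q e n Y" "i \<in> {1..n}" "\<omega> \<in> space M"
  shows "Y i \<omega> \<in> {0, 1}"
  using assms measurable_space[of "Y i" M "count_space {0, 1}" \<omega>]
  unfolding course_process_def by auto

lemma sets_path_event:
  assumes cp: "course_process M F q e n Y" and "j \<le> n"
  shows "path_event M Y S j \<in> sets M"
  unfolding path_event_def
proof (rule sets.sets_Collect_finite_All)
  fix i assume i: "i \<in> {1..j}"
  then have "Y i \<in> measurable M (count_space {0, 1})"
    using cp \<open>j \<le> n\<close> unfolding course_process_def by auto
  from measurable_sets[OF this, of "{of_bool (i \<in> S)}"]
  have "Y i -` {of_bool (i \<in> S)} \<inter> space M \<in> sets M" by simp
  also have "Y i -` {of_bool (i \<in> S)} \<inter> space M = {\<omega> \<in> space M. Y i \<omega> = of_bool (i \<in> S)}"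
    by auto
  finally show "{\<omega> \<in> space M. Y i \<omega> = of_bool (i \<in> S)} \<in> sets M" .
qed simp

text \<open>
  One step of the process. The recursion also covers the first session (\<open>j = 0\<close>), where the event
  conditioned on is the whole space; the case of a session that is not understood is the complement
  of the case of a session that is.
\<close>
lemma path_prob_Suc:
  assumes cp: "course_process M F q e n Y" and "j < n"
    and pos: "measure M (path_event M Y S j) > 0"
  defines "g \<equiv> tail_fun F (1 - q + (real j - 2 * real (card (S \<inter> {1..j}))) * e)"
  shows "measure M (path_event M Y S (Suc j)) =
    measure M (path_event M Y S j) * (if Suc j \<in> S then g else 1 - g)"
proof -
  interpret prob_space M using cp unfolding course_process_def by simp
  let ?E = "path_event M Y S"
  define A where "A = {\<omega> \<in> space M. Y (Suc j) \<omega> = 1 \<and> (\<forall>i\<in>{1..j}. Y i \<omega> = of_bool (i \<in> S))}"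
  have card: "(\<Sum>i=1..j. of_bool (i \<in> S)) = card (S \<inter> {1..j})"
    by (simp add: Int_commute)
  have A: "measure M A = measure M (?E j) * g"
  proof (cases "j = 0")
    case True
    then show ?thesis
      using cp by (simp add: course_process_def A_def path_event_def g_def prob_space)
  next
    case False
    then have "j \<in> {1..<n}" using \<open>j < n\<close> by simp
    then have "\<forall>x \<in> {1..j} \<rightarrow> {0, 1}. \<P>(\<omega> in M. \<forall>i\<in>{1..j}. Y i \<omega> = x i) > 0 \<longrightarrow>
        \<P>(\<omega> in M. Y (j + 1) \<omega> = 1 \<bar> \<forall>i\<in>{1..j}. Y i \<omega> = x i) =
          tail_fun F (1 - q + (real j - 2 * real (\<Sum>i=1..j. x i)) * e)"
      using cp unfolding course_process_def by blast
    note law = bspec[OF this, of "\<lambda>i. of_bool (i \<in> S)"]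
    have "(\<lambda>i. of_bool (i \<in> S)) \<in> {1..j} \<rightarrow> {0, 1 :: nat}" by auto
    moreover have "\<P>(\<omega> in M. \<forall>i\<in>{1..j}. Y i \<omega> = of_bool (i \<in> S)) > 0"
      using pos by (simp add: path_event_def)
    ultimately have "\<P>(\<omega> in M. Y (j + 1) \<omega> = 1 \<bar> \<forall>i\<in>{1..j}. Y i \<omega> = of_bool (i \<in> S)) = 
       tail_fun F (1 - q + (real j - 2 * real (\<Sum>i=1..j. of_bool (i \<in> S))) * e)"
      using law by blast
    then have "measure M A / measure M (?E j) = g"
      unfolding card cond_prob_def g_def A_def path_event_def by simp
    then show ?thesis using pos by (simp add: field_simps)
  qed
  show ?thesis
  proof (cases "Suc j \<in> S")
    case True
    have "?E (Suc j) = A"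
      unfolding path_event_def A_def using True by (auto simp: le_Suc_eq)
    then show ?thesis using A True by simp
  next
    case False
    have val: "Y (Suc j) \<omega> = 0 \<longleftrightarrow> Y (Suc j) \<omega> \<noteq> 1" if "\<omega> \<in> space M" for \<omega>
      using course_process_value[OF cp, of "Suc j" \<omega>] \<open>j < n\<close> that by auto
    \<comment> \<open>As an outcome of \<open>Suc j\<close> sessions, \<open>A\<close> is seen to be measurable.\<close>
    have A_eq: "A = path_event M Y (insert (Suc j) S) (Suc j)"
      unfolding path_event_def A_def by (auto simp: le_Suc_eq)
    have "?E (Suc j) = ?E j - A"
      unfolding path_event_def A_def using False val by (auto simp: atLeastAtMostSuc_conv)
    moreover have "measure M (?E j - A) = measure M (?E j) - measure M A"
    proof (rule finite_measure_Diff)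
      show "?E j \<in> sets M" using sets_path_event[OF cp] \<open>j < n\<close> by simp
      show "A \<in> sets M" unfolding A_eq using sets_path_event[OF cp] \<open>j < n\<close> by simp
      show "A \<subseteq> ?E j" by (auto simp: A_def path_event_def)
    qed
    ultimately show ?thesis using A False by (simp add: algebra_simps)
  qed
qed

text \<open>
  The lower bound also serves the induction itself: it is positive because \<open>r < 1\<close>, so every
  outcome has positive probability and the conditional law always applies. The error is measured
  against \<open>min p (1 - p)\<close> so that it is a relative error \<open>r\<close> for \<open>p\<close> and for \<open>1 - p\<close> alike.
\<close>
lemma path_prob_bounds:
  fixes S :: "nat set"
  assumes cp: "course_process M F q e n Y"
    and p: "0 < p" "p < 1" and r: "0 \<le> r" "r < 1"
    and tail: "\<And>j s. j < n \<Longrightarrow> s \<le> j \<Longrightarrow>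
      \<bar>tail_fun F (1 - q + (real j - 2 * real s) * e) - p\<bar> \<le> r * min p (1 - p)"
    and "j \<le> n"
  defines "w \<equiv> \<lambda>j. \<Prod>i=1..j. if i \<in> S then p else 1 - p"
  shows "(1 - r) ^ j * w j \<le> measure M (path_event M Y S j) \<and>
    measure M (path_event M Y S j) \<le> (1 + r) ^ j * w j"
  using \<open>j \<le> n\<close>
proof (induction j)
  case 0
  interpret prob_space M using cp unfolding course_process_def by simp
  show ?case by (simp add: path_event_def w_def prob_space)
next
  case (Suc j)
  let ?P = "measure M (path_event M Y S j)"
  let ?a = "if Suc j \<in> S then p else 1 - p"
  from Suc have IH: "(1 - r) ^ j * w j \<le> ?P" "?P \<le> (1 + r) ^ j * w j" by simp_all
  have w: "w j > 0" unfolding w_def using p by (intro prod_pos) auto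
  then have pos: "?P > 0" using IH(1) r by (smt (verit) mult_pos_pos zero_less_power)
  define g where "g = tail_fun F (1 - q + (real j - 2 * real (card (S \<inter> {1..j}))) * e)"
  let ?g = "if Suc j \<in> S then g else 1 - g"
  have step: "measure M (path_event M Y S (Suc j)) = ?P * ?g"
    using path_prob_Suc[OF cp _ pos] Suc.prems by (simp add: g_def)
  have "card (S \<inter> {1..j}) \<le> j"
    using card_mono[of "{1..j}" "S \<inter> {1..j}"] by simp
  then have "\<bar>g - p\<bar> \<le> r * min p (1 - p)"
    using tail Suc.prems by (simp add: g_def)
  moreover have "r * min p (1 - p) \<le> r * p" "r * min p (1 - p) \<le> r * (1 - p)"
    using r by (auto intro: mult_left_mono)
  ultimately have g: "(1 - r) * ?a \<le> ?g" "?g \<le> (1 + r) * ?a"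
    by (auto simp: algebra_simps abs_le_iff)
  have a: "?a > 0" using p by simp
  then have g0: "?g \<ge> 0" using g(1) r by (smt (verit) mult_nonneg_nonneg)
  have w_Suc: "w (Suc j) = w j * ?a" by (simp add: w_def)
  have "((1 - r) ^ j * w j) * ((1 - r) * ?a) \<le> ?P * ?g"
    using IH(1) g(1) pos r a by (intro mult_mono) auto
  moreover have "?P * ?g \<le> ((1 + r) ^ j * w j) * ((1 + r) * ?a)"
    using IH(2) g(2) g0 w r by (intro mult_mono) auto
  ultimately show ?case unfolding step w_Suc by (simp add: algebra_simps)
qed

section \<open>Probability of a number of understood sessions\<close>

lemma count_prob_eq_sum_path_prob:
  assumes cp: "course_process M F q e n Y"
  shows "\<P>(\<omega> in M. (\<Sum>j=1..n. Y j \<omega>) = k) =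
    (\<Sum>S | S \<subseteq> {1..n} \<and> card S = k. measure M (path_event M Y S n))"
proof -
  interpret prob_space M using cp unfolding course_process_def by simp
  let ?I = "{S. S \<subseteq> {1..n} \<and> card S = k}"
  have sum_path: "(\<Sum>j=1..n. Y j \<omega>) = card S"
    if "S \<subseteq> {1..n}" "\<omega> \<in> path_event M Y S n" for S \<omega>
  proof -
    have "(\<Sum>j=1..n. Y j \<omega>) = (\<Sum>j=1..n. of_bool (j \<in> S))"
      using that by (intro sum.cong) (auto simp: path_event_def)
    also have "\<dots> = card S" using that(1) by (simp add: Int_absorb1)
    finally show ?thesis .
  qed
  have "{\<omega> \<in> space M. (\<Sum>j=1..n. Y j \<omega>) = k} = (\<Union>S\<in>?I. path_event M Y S n)"
  proof (intro equalityI subsetI)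
    fix \<omega> assume \<omega>: "\<omega> \<in> {\<omega> \<in> space M. (\<Sum>j=1..n. Y j \<omega>) = k}"
    define S where "S = {i \<in> {1..n}. Y i \<omega> = 1}"
    have "Y i \<omega> = of_bool (i \<in> S)" if "i \<in> {1..n}" for i
      using course_process_value[OF cp that] \<omega> that by (auto simp: S_def)
    then have mem: "\<omega> \<in> path_event M Y S n" using \<omega> by (simp add: path_event_def)
    have S: "S \<subseteq> {1..n}" by (auto simp: S_def)
    with sum_path[OF S mem] \<omega> mem show "\<omega> \<in> (\<Union>S\<in>?I. path_event M Y S n)" by auto
  next
    fix \<omega> assume "\<omega> \<in> (\<Union>S\<in>?I. path_event M Y S n)"
    then show "\<omega> \<in> {\<omega> \<in> space M. (\<Sum>j=1..n. Y j \<omega>) = k}"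
      using sum_path by (auto simp: path_event_def)
  qed
  moreover have "measure M (\<Union>S\<in>?I. path_event M Y S n) =
      (\<Sum>S\<in>?I. measure M (path_event M Y S n))"
  proof (rule finite_measure_finite_Union)
    show "finite ?I" by simp
    show "(\<lambda>S. path_event M Y S n) ` ?I \<subseteq> sets M"
      using sets_path_event[OF cp] by auto
    show "disjoint_family_on (\<lambda>S. path_event M Y S n) ?I"
      unfolding disjoint_family_on_def
    proof (intro ballI impI)
      fix S T assume ST: "S \<in> ?I" "T \<in> ?I" "S \<noteq> T"
      then obtain i where "i \<in> {1..n}" "(i \<in> S) \<noteq> (i \<in> T)" by blast
      then show "path_event M Y S n \<inter> path_event M Y T n = {}"
        unfolding path_event_def by (auto dest!: bspec[of _ _ i])
    qed
  qed
  ultimately show ?thesis by simp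
qed

lemma count_prob_bounds:
  fixes k :: nat
  assumes cp: "course_process M F q e n Y"
    and p: "0 < p" "p < 1" and r: "0 \<le> r" "r < 1"
    and tail: "\<And>j s. j < n \<Longrightarrow> s \<le> j \<Longrightarrow>
      \<bar>tail_fun F (1 - q + (real j - 2 * real s) * e) - p\<bar> \<le> r * min p (1 - p)"
  defines "b \<equiv> real (n choose k) * p ^ k * (1 - p) ^ (n - k)"
  shows "(1 - r) ^ n * b \<le> \<P>(\<omega> in M. (\<Sum>j=1..n. Y j \<omega>) = k)"
    and "\<P>(\<omega> in M. (\<Sum>j=1..n. Y j \<omega>) = k) \<le> (1 + r) ^ n * b"
proof -
  let ?I = "{S. S \<subseteq> {1..n} \<and> card S = k}"
  have weight: "(\<Prod>i=1..n. if i \<in> S then p else 1 - p) = p ^ k * (1 - p) ^ (n - k)"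
    if "S \<in> ?I" for S
  proof -
    have "{1..n} \<inter> S = S" "{1..n} \<inter> - S = {1..n} - S" using that by auto
    moreover have "card ({1..n} - S) = n - k"
      using that finite_subset[of S "{1..n}"] by (simp add: card_Diff_subset)
    ultimately show ?thesis using that by (simp add: prod.If_cases)
  qed
  have path: "(1 - r) ^ n * (p ^ k * (1 - p) ^ (n - k)) \<le> measure M (path_event M Y S n)"
      "measure M (path_event M Y S n) \<le> (1 + r) ^ n * (p ^ k * (1 - p) ^ (n - k))"
    if "S \<in> ?I" for S
    using path_prob_bounds[OF cp p r tail order.refl, where S = S] weight[OF that] by simp_all
  have card: "real (card ?I) = real (n choose k)"
    using n_subsets[of "{1..n}" k] by simp
  have below: "real (card ?I) * ((1 - r) ^ n * (p ^ k * (1 - p) ^ (n - k)))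
      \<le> (\<Sum>S\<in>?I. measure M (path_event M Y S n))"
    by (rule sum_bounded_below) (rule path(1))
  show "(1 - r) ^ n * b \<le> \<P>(\<omega> in M. (\<Sum>j=1..n. Y j \<omega>) = k)"
    unfolding count_prob_eq_sum_path_prob[OF cp]
    using below unfolding card b_def by (simp add: mult_ac)
  have above: "(\<Sum>S\<in>?I. measure M (path_event M Y S n))
      \<le> real (card ?I) * ((1 + r) ^ n * (p ^ k * (1 - p) ^ (n - k)))"
    by (rule sum_bounded_above) (rule path(2))
  show "\<P>(\<omega> in M. (\<Sum>j=1..n. Y j \<omega>) = k) \<le> (1 + r) ^ n * b"
    unfolding count_prob_eq_sum_path_prob[OF cp]
    using above unfolding card b_def by (simp add: mult_ac)
qed

section \<open>The limit\<close>

theorem theorem3p3: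
  fixes F f :: "real \<Rightarrow> real" and q p :: real
    and \<epsilon> :: "nat \<Rightarrow> real"
    and M :: "nat \<Rightarrow> 'a measure"
    and Y :: "nat \<Rightarrow> nat \<Rightarrow> 'a \<Rightarrow> nat"
    and k :: "nat \<Rightarrow> nat"
  assumes "is_density_of f F"
    and "isCont f (1 - q)"
    and "p = tail_fun F (1 - q)" and "0 < p" and "p < 1"
    and "\<And>n. n \<ge> 1 \<Longrightarrow> \<epsilon> n > 0"
    and "(\<lambda>n. (real n)\<^sup>2 * \<epsilon> n) \<longlonglongrightarrow> 0"
    and "\<And>n. n \<ge> 1 \<Longrightarrow> course_process (M n) F q (\<epsilon> n) n (Y n)"
    and "\<And>n. n \<ge> 1 \<Longrightarrow> k n \<le> n"
  shows "(\<lambda>n. \<P>(\<omega> in M n. (\<Sum>j=1..n. Y n j \<omega>) = k n) /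
              (real (n choose k n) * p ^ k n * (1 - p) ^ (n - k n))) \<longlonglongrightarrow> 1"
proof -
  define \<mu> where "\<mu> = min p (1 - p)"
  have \<mu>: "\<mu> > 0" using assms(4,5) by (simp add: \<mu>_def)
  obtain K \<delta> where K: "K > 0" and \<delta>: "\<delta> > 0"
    and lip: "\<And>h. \<bar>h\<bar> \<le> \<delta> \<Longrightarrow> \<bar>tail_fun F (1 - q + h) - p\<bar> \<le> K * \<bar>h\<bar>"
    using tail_fun_lipschitz_at[OF assms(1,2)] unfolding assms(3) by metis
  define r where "r = (\<lambda>n. K * (real n * \<epsilon> n) / \<mu>)"
  define u where "u = (\<lambda>n. (real n)\<^sup>2 * \<epsilon> n)"
  let ?R = "\<lambda>n. \<P>(\<omega> in M n. (\<Sum>j=1..n. Y n j \<omega>) = k n) /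
              (real (n choose k n) * p ^ k n * (1 - p) ^ (n - k n))"
  have u: "u \<longlonglongrightarrow> 0" using assms(7) by (simp add: u_def)
  have nr: "real n * r n = (K / \<mu>) * u n" for n
    by (simp add: r_def u_def power2_eq_square)
  have nr_lim: "(\<lambda>n. real n * r n) \<longlonglongrightarrow> 0"
    unfolding nr using tendsto_mult_left[OF u, of "K / \<mu>"] by simp
  have "eventually (\<lambda>n. u n < \<delta>) sequentially"
    "eventually (\<lambda>n. real n * r n < 1) sequentially"
    using order_tendstoD(2)[OF u \<delta>] order_tendstoD(2)[OF nr_lim, of 1] by simp_all
  \<comment> \<open>For \<open>n \<ge> 1\<close>, \<open>n * \<epsilon> n \<le> u n\<close> and \<open>r n \<le> n * r n\<close>, so the two eventual bounds keep the
    arguments in the Lipschitz range and make \<open>r n < 1\<close>.\<close>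
  then have bounds: "eventually (\<lambda>n. 1 - real n * r n \<le> ?R n \<and> ?R n \<le> exp (real n * r n)) sequentially"
    using eventually_ge_at_top[of 1]
  proof eventually_elim
    case (elim n)
    have n: "real n \<ge> 1" using elim by simp
    have \<epsilon>: "\<epsilon> n > 0" using assms(6) elim by simp
    have "real n * \<epsilon> n \<le> u n"
      using n \<epsilon> by (simp add: u_def power2_eq_square)
    then have small: "real n * \<epsilon> n \<le> \<delta>" using elim by simp
    have r0: "r n \<ge> 0" using K \<mu> \<epsilon> by (simp add: r_def)
    have "r n \<le> real n * r n" using n r0 mult_right_mono[of 1 "real n" "r n"] by simp
    then have r1: "r n < 1" using elim by simp
    have tail: "\<bar>tail_fun F (1 - q + (real j - 2 * real s) * \<epsilon> n) - p\<bar> \<le> r n * min p (1 - p)"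
      if "j < n" "s \<le> j" for j s
    proof -
      have "\<bar>real j - 2 * real s\<bar> \<le> real n" using that by linarith
      then have h: "\<bar>(real j - 2 * real s) * \<epsilon> n\<bar> \<le> real n * \<epsilon> n"
        using \<epsilon> by (simp add: abs_mult)
      then have "\<bar>tail_fun F (1 - q + (real j - 2 * real s) * \<epsilon> n) - p\<bar>
          \<le> K * \<bar>(real j - 2 * real s) * \<epsilon> n\<bar>"
        using small by (intro lip) linarith
      also have "\<dots> \<le> K * (real n * \<epsilon> n)"
        using h K by (intro mult_left_mono) auto
      also have "\<dots> = r n * min p (1 - p)"
        using \<mu> by (simp add: r_def flip: \<mu>_def)
      finally show ?thesis .
    qed
    have "k n \<le> n" using assms(9) elim by simp
    then have b: "real (n choose k n) * p ^ k n * (1 - p) ^ (n - k n) > 0"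
      using assms(4,5) by simp
    note count = count_prob_bounds[OF assms(8)[OF elim(3)] assms(4,5) r0 r1 tail, where k = "k n"]
    have "(1 - r n) ^ n \<le> ?R n" "?R n \<le> (1 + r n) ^ n"
      using count elim b by (simp_all add: pos_le_divide_eq pos_divide_le_eq)
    \<comment> \<open>Bounds through \<open>n * r n\<close> alone, the quantity that is known to tend to 0.\<close>
    moreover have "1 - real n * r n \<le> (1 - r n) ^ n"
      using Bernoulli_inequality[of "- r n" n] r1 by simp
    moreover have "(1 + r n) ^ n \<le> exp (r n) ^ n"
      using r0 by (intro power_mono) auto
    ultimately show ?case by (simp add: exp_of_nat_mult)
  qed
  have "(\<lambda>n. 1 - real n * r n) \<longlonglongrightarrow> 1"
    using tendsto_diff[OF tendsto_const nr_lim, of 1] by simp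
  moreover have "(\<lambda>n. exp (real n * r n)) \<longlonglongrightarrow> 1"
    using tendsto_exp[OF nr_lim] by simp
  ultimately show ?thesis
    using bounds by (intro tendsto_sandwich[of "\<lambda>n. 1 - real n * r n" ?R sequentially
      "\<lambda>n. exp (real n * r n)"]) (auto elim: eventually_mono)
qed

end
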